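(* Let $V=\mathbb R^n$ and fix integers $r,d$ with $0<r<r+d\le n$. Let $W\subseteq\bigwedge^r V$ be a linear subspace. Then there exists a nonempty Zariski open subset of $GL_n(\mathbb R)$ all of whose elements $F$ satisfy $$\frac{\dim\left(W\wedge\bigwedge^d V\right)}{\binom{n}{r+d}}\ge\frac{\dim\pi^F_{[n-d]}(W)}{\binom{n-d}{r}}=\max_{J^*,F^*}\frac{\dim\pi^{F^*}_{J^*}(W)}{\binom{n-d}{r}},$$ where the maximum is taken over all $J^*\in\binom{[n]}{n-d}$ and $F^*\in GL_n(\mathbb R)$.
   Context: $[k]=\{1,\dots,k\}$ and $\binom{[n]}{k}$ is the set of $k$-element subsets of $[n]$. For linear subspaces $U,W$ of $\bigwedge V$, $U\wedge W=\operatorname{span}\{u\wedge w:u\in U,w\in W\}$. For $F\in GL_n(\mathbb R)$ with columns $f_1,\dots,f_n$ (a basis of $V$) and $J\subseteq[n]$, let $V_J=\operatorname{span}\{f_j:j\in J\}$ and let $\pi^F_J:V\to V_J$ be the linear projection $\pi^F_J\left(\sum_{j\in[n]}\alpha_jf_j\right)=\sum_{j\in J}\alpha_jf_j$. The same symbol $\pi^F_J:\bigwedge^r V\to\bigwedge^r V_J$ denotes the induced map on exterior powers: with $f_A=\bigwedge_{a\in A}f_a$ (indices increasing), $\pi^F_J(f_A)=f_A$ if $A\subseteq J$ and $0$ otherwise. Zariski open refers to the $n^2$ matrix entries as coordinates. *)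

theory Defs
  imports "HOL-Analysis.Analysis"
begin

section \<open>The exterior algebra of \<open>real^'n\<close>\<close>

text \<open>
  A finite linearly ordered type \<open>'n\<close> plays the role of the index set \<open>{1,...,n}\<close>, with
  \<open>n = CARD('n)\<close>.  The exterior algebra of \<open>V = real^'n\<close> is realised on its standard basis
  \<open>(e_A)\<close>, where \<open>A\<close> ranges over all subsets of the index set: an element is the vector of
  its coordinates with respect to that basis, and \<open>e_A\<close> is \<open>axis A 1\<close>.
\<close>

type_synonym 'n rvec = "(real, 'n) vec"
type_synonym 'n rmat = "((real, 'n) vec, 'n) vec"
type_synonym 'n ext = "(real, 'n set) vec"

text \<open>
  For disjoint \<open>A\<close> and \<open>B\<close>, the sign of the permutation that sorts the increasing list of \<open>A\<close>
  followed by the increasing list of \<open>B\<close>.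
\<close>

definition ext_sign :: "'n::linorder set \<Rightarrow> 'n set \<Rightarrow> real" where
  "ext_sign A B = (-1) ^ card {(a, b). a \<in> A \<and> b \<in> B \<and> b < a}"

definition wedge :: "'n::{finite,linorder} ext \<Rightarrow> 'n ext \<Rightarrow> 'n ext" where
  "wedge x y = (\<chi> C. \<Sum>A\<in>Pow C. ext_sign A (C - A) * x $ A * y $ (C - A))"

definition ext_of_vec :: "'n rvec \<Rightarrow> 'n::{finite,linorder} ext" where
  "ext_of_vec v = (\<Sum>i\<in>UNIV. v $ i *\<^sub>R axis {i} 1)"

definition wedge_list :: "'n rvec list \<Rightarrow> 'n::{finite,linorder} ext" where
  "wedge_list vs = foldr (\<lambda>v x. wedge (ext_of_vec v) x) vs (axis {} 1)"

definition ext_power :: "nat \<Rightarrow> 'n rvec set \<Rightarrow> 'n::{finite,linorder} ext set" where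
  "ext_power r S = span {wedge_list vs |vs. length vs = r \<and> set vs \<subseteq> S}"

definition wedge_space :: "'n ext set \<Rightarrow> 'n ext set \<Rightarrow> 'n::{finite,linorder} ext set" where
  "wedge_space U W = span {wedge u w |u w. u \<in> U \<and> w \<in> W}"

section \<open>Coordinate projections with respect to a basis\<close>

definition col_wedge :: "'n rmat \<Rightarrow> 'n set \<Rightarrow> 'n::{finite,linorder} ext" where
  "col_wedge F A = wedge_list (map (\<lambda>a. column a F) (sorted_list_of_set A))"

text \<open>
  For invertible \<open>F\<close>, the coordinates of \<open>v\<close> in the basis of columns of \<open>F\<close> are the entries
  of \<open>matrix_inv F *v v\<close>.
\<close>

definition vec_proj :: "'n rmat \<Rightarrow> 'n set \<Rightarrow> 'n rvec \<Rightarrow> 'n::finite rvec" where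
  "vec_proj F J v = (\<Sum>j\<in>J. (matrix_inv F *v v) $ j *\<^sub>R column j F)"

text \<open>
  The map on the exterior algebra induced by a linear map \<open>L\<close> on \<open>V\<close>: it sends \<open>e_A\<close> to the
  wedge, in increasing order of the indices, of the vectors \<open>L e_a\<close> with \<open>a \<in> A\<close>.
\<close>

definition ext_map :: "('n rvec \<Rightarrow> 'n rvec) \<Rightarrow> 'n ext \<Rightarrow> 'n::{finite,linorder} ext" where
  "ext_map L x =
     (\<Sum>A\<in>UNIV. x $ A *\<^sub>R wedge_list (map (\<lambda>a. L (axis a 1)) (sorted_list_of_set A)))"

definition ext_proj :: "'n rmat \<Rightarrow> 'n set \<Rightarrow> 'n ext \<Rightarrow> 'n::{finite,linorder} ext" where
  "ext_proj F J = ext_map (vec_proj F J)"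

section \<open>Initial index segments and Zariski open sets of matrices\<close>

text \<open>
  The counterpart of \<open>{1,...,k}\<close>: the position of \<open>j\<close> in the linear order is
  \<open>card {i. i \<le> j}\<close>.
\<close>

definition first_indices :: "nat \<Rightarrow> 'n::{finite,linorder} set" where
  "first_indices k = {j. card {i. i \<le> j} \<le> k}"

definition general_linear :: "'n::finite rmat set" where
  "general_linear = {F. invertible F}"

text \<open>
  On the space of matrices, \<^const>\<open>real_polynomial_function\<close> means polynomial in the entries.
\<close>

definition zariski_closed :: "'n::finite rmat set \<Rightarrow> bool" where
  "zariski_closed Z \<longleftrightarrow>
     (\<exists>P. (\<forall>p\<in>P. real_polynomial_function p) \<and> Z = {F. \<forall>p\<in>P. p F = 0})"

definition zariski_open_in_GL :: "'n::finite rmat set \<Rightarrow> bool" where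
  "zariski_open_in_GL U \<longleftrightarrow> (\<exists>Z. zariski_closed Z \<and> U = general_linear - Z)"

section \<open>Basic properties\<close>

text \<open>
  \<open>wedge\<close> is a bilinear associative product with unit \<open>e_{}\<close>, alternating on \<open>V\<close>; \<open>e_A\<close>
  is the ordered product of the standard basis vectors indexed by \<open>A\<close>; and \<open>ext_power r UNIV\<close>
  is spanned by the \<open>e_A\<close> with \<open>card A = r\<close>.
\<close>

lemma linear_eq_axis:
  fixes f g :: "real ^ 'm \<Rightarrow> 'b::real_vector"
  assumes "linear f" "linear g" "\<And>A. f (axis A 1) = g (axis A 1)"
  shows "f x = g x"
proof -
  have x: "x = (\<Sum>i\<in>UNIV. x $ i *\<^sub>R axis i 1)"
    using basis_expansion[of x] by (simp add: scalar_mult_eq_scaleR)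
  show ?thesis
    by (subst (1 2) x) (simp add: linear_sum[OF assms(1)] linear_sum[OF assms(2)]
        linear_cmul[OF assms(1)] linear_cmul[OF assms(2)] assms(3))
qed

lemma bilinear_wedge: "bilinear wedge"
  unfolding bilinear_def linear_iff
  by (auto simp: wedge_def vec_eq_iff sum.distrib algebra_simps sum_distrib_left)

lemma linear_wedge_left: "linear (\<lambda>x. wedge x y)"
  and linear_wedge_right: "linear (\<lambda>y. wedge x y)"
  using bilinear_wedge unfolding bilinear_def by auto

lemmas wedge_simps =
  linear_0[OF linear_wedge_left] linear_0[OF linear_wedge_right]
  linear_add[OF linear_wedge_left] linear_add[OF linear_wedge_right]
  linear_cmul[OF linear_wedge_left] linear_cmul[OF linear_wedge_right]
  linear_neg[OF linear_wedge_left] linear_neg[OF linear_wedge_right]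
  linear_sum[OF linear_wedge_left] linear_sum[OF linear_wedge_right]

lemma wedge_axis:
  "wedge (axis A 1) (axis B 1) =
     (if A \<inter> B = {} then ext_sign A B *\<^sub>R axis (A \<union> B) 1 else 0)"
proof -
  have "(\<Sum>A'\<in>Pow C. ext_sign A' (C - A') * axis A 1 $ A' * axis B 1 $ (C - A')) =
      (if A \<inter> B = {} then ext_sign A B *\<^sub>R axis (A \<union> B) 1 else 0) $ C" for C
  proof -
    have "(\<Sum>A'\<in>Pow C. ext_sign A' (C - A') * axis A 1 $ A' * axis B 1 $ (C - A')) =
        (\<Sum>A'\<in>Pow C. if A' = A then (if C - A = B then ext_sign A B else 0) else 0)"
      by (intro sum.cong) (auto simp: axis_def)
    also have "\<dots> = (if A \<subseteq> C \<and> C - A = B then ext_sign A B else 0)"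
      by (simp add: sum.delta)
    also have "A \<subseteq> C \<and> C - A = B \<longleftrightarrow> A \<inter> B = {} \<and> C = A \<union> B"
      by auto
    finally show ?thesis
      by (auto simp: axis_def)
  qed
  then show ?thesis
    by (simp add: wedge_def vec_eq_iff)
qed

lemma ext_sign_Un_left:
  fixes A B C :: "'n::{finite,linorder} set"
  assumes "A \<inter> B = {}"
  shows "ext_sign (A \<union> B) C = ext_sign A C * ext_sign B C"
proof -
  have "{(a, b). a \<in> A \<union> B \<and> b \<in> C \<and> b < a} =
      {(a, b). a \<in> A \<and> b \<in> C \<and> b < a} \<union> {(a, b). a \<in> B \<and> b \<in> C \<and> b < a}"
    by auto
  moreover have
    "{(a, b). a \<in> A \<and> b \<in> C \<and> b < a} \<inter> {(a, b). a \<in> B \<and> b \<in> C \<and> b < a} = {}"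
    using assms by auto
  ultimately show ?thesis
    by (simp add: ext_sign_def card_Un_disjoint power_add)
qed

lemma ext_sign_Un_right:
  fixes A B C :: "'n::{finite,linorder} set"
  assumes "B \<inter> C = {}"
  shows "ext_sign A (B \<union> C) = ext_sign A B * ext_sign A C"
proof -
  have "{(a, b). a \<in> A \<and> b \<in> B \<union> C \<and> b < a} =
      {(a, b). a \<in> A \<and> b \<in> B \<and> b < a} \<union> {(a, b). a \<in> A \<and> b \<in> C \<and> b < a}"
    by auto
  moreover have
    "{(a, b). a \<in> A \<and> b \<in> B \<and> b < a} \<inter> {(a, b). a \<in> A \<and> b \<in> C \<and> b < a} = {}"
    using assms by auto
  ultimately show ?thesis
    by (simp add: ext_sign_def card_Un_disjoint power_add)
qed

lemma ext_sign_empty [simp]: "ext_sign {} B = 1" "ext_sign A {} = 1"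
  by (auto simp: ext_sign_def)

lemma wedge_unit_left: "wedge (axis {} 1) x = x"
  by (rule linear_eq_axis[OF linear_wedge_right linear_id[unfolded id_def]])
    (simp add: wedge_axis)

lemma wedge_unit_right: "wedge x (axis {} 1) = x"
  by (rule linear_eq_axis[OF linear_wedge_left linear_id[unfolded id_def]])
    (simp add: wedge_axis)

lemma wedge_assoc: "wedge (wedge x y) z = wedge x (wedge y z)"
proof -
  have 1: "wedge (wedge (axis A 1) (axis B 1)) (axis C 1) =
      wedge (axis A 1) (wedge (axis B 1) (axis C 1))" for A B C :: "'a set"
    by (auto simp: wedge_axis wedge_simps ext_sign_Un_left ext_sign_Un_right
        Int_Un_distrib Int_Un_distrib2 Un_assoc)
  have 2: "wedge (wedge (axis A 1) (axis B 1)) z =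
      wedge (axis A 1) (wedge (axis B 1) z)" for A B
    by (rule linear_eq_axis[where f = "\<lambda>z. wedge (wedge (axis A 1) (axis B 1)) z"
          and g = "\<lambda>z. wedge (axis A 1) (wedge (axis B 1) z)", OF _ _ 1])
      (simp_all add: linear_iff wedge_simps)
  have 3: "wedge (wedge (axis A 1) y) z = wedge (axis A 1) (wedge y z)" for A
    by (rule linear_eq_axis[where f = "\<lambda>y. wedge (wedge (axis A 1) y) z"
          and g = "\<lambda>y. wedge (axis A 1) (wedge y z)", OF _ _ 2])
      (simp_all add: linear_iff wedge_simps)
  show ?thesis
    by (rule linear_eq_axis[where f = "\<lambda>x. wedge (wedge x y) z"
          and g = "\<lambda>x. wedge x (wedge y z)", OF _ _ 3])
      (simp_all add: linear_iff wedge_simps)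
qed

lemma linear_ext_of_vec: "linear ext_of_vec"
  unfolding linear_iff
  by (auto simp: ext_of_vec_def algebra_simps sum.distrib scaleR_sum_right)

lemma ext_of_vec_axis: "ext_of_vec (axis i 1) = axis {i} 1"
proof -
  have "ext_of_vec (axis i 1) =
      (\<Sum>j\<in>UNIV. if j = i then axis {i} 1 else (0 :: 'a ext))"
    unfolding ext_of_vec_def by (intro sum.cong) (auto simp: axis_def)
  then show ?thesis by simp
qed

lemma wedge_axis_single_swap:
  "wedge (axis {i} 1) (axis {j} 1) = - wedge (axis {j} 1) (axis {i::'n::{finite,linorder}} 1)"
proof -
  have *: "ext_sign {i} {j} = (if j < i then -1 else 1)" for i j :: 'n
  proof -
    have "{(a, b). a \<in> {i} \<and> b \<in> {j} \<and> b < a} = (if j < i then {(i, j)} else {})"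
      by auto
    then show ?thesis by (simp add: ext_sign_def)
  qed
  show ?thesis
    by (auto simp: wedge_axis * insert_commute not_less)
qed

lemma wedge_vec_swap:
  "wedge (ext_of_vec u) (ext_of_vec v) = - wedge (ext_of_vec v) (ext_of_vec u)"
proof -
  have 1: "wedge (ext_of_vec (axis i 1)) (ext_of_vec (axis j 1)) =
      - wedge (ext_of_vec (axis j 1)) (ext_of_vec (axis i 1))" for i j
    unfolding ext_of_vec_axis by (rule wedge_axis_single_swap)
  note s = linear_add[OF linear_ext_of_vec] linear_cmul[OF linear_ext_of_vec] wedge_simps
  have 2: "wedge (ext_of_vec (axis i 1)) (ext_of_vec v) =
      - wedge (ext_of_vec v) (ext_of_vec (axis i 1))" for i
    by (rule linear_eq_axis[where f = "\<lambda>v. wedge (ext_of_vec (axis i 1)) (ext_of_vec v)"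
          and g = "\<lambda>v. - wedge (ext_of_vec v) (ext_of_vec (axis i 1))", OF _ _ 1])
      (simp_all add: linear_iff s)
  show ?thesis
    by (rule linear_eq_axis[where f = "\<lambda>u. wedge (ext_of_vec u) (ext_of_vec v)"
          and g = "\<lambda>u. - wedge (ext_of_vec v) (ext_of_vec u)", OF _ _ 2])
      (simp_all add: linear_iff s)
qed

lemma wedge_vec_self: "wedge (ext_of_vec v) (ext_of_vec v) = 0"
proof -
  have "2 *\<^sub>R wedge (ext_of_vec v) (ext_of_vec v) = 0"
    using wedge_vec_swap[of v v] by (simp add: scaleR_2 eq_neg_iff_add_eq_0)
  then show ?thesis by simp
qed

lemma wedge_vec_swap_left:
  "wedge (ext_of_vec u) (wedge (ext_of_vec v) x) = - wedge (ext_of_vec v) (wedge (ext_of_vec u) x)"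
  unfolding wedge_assoc[symmetric]
  by (subst wedge_vec_swap[of u v]) (rule linear_neg[OF linear_wedge_left])

lemma wedge_list_simps [simp]:
  "wedge_list [] = axis {} 1"
  "wedge_list (v # vs) = wedge (ext_of_vec v) (wedge_list vs)"
  by (auto simp: wedge_list_def)

lemma wedge_list_repeat: "v \<in> set vs \<Longrightarrow> wedge (ext_of_vec v) (wedge_list vs) = 0"
proof (induction vs)
  case (Cons u vs)
  show ?case
  proof (cases "v = u")
    case True
    then show ?thesis
      by (simp flip: wedge_assoc add: wedge_vec_self wedge_simps)
  next
    case False
    then show ?thesis
      using Cons wedge_vec_swap_left[of v u "wedge_list vs"] by (simp add: wedge_simps)
  qed
qed auto

lemma wedge_list_zero: "0 \<in> set vs \<Longrightarrow> wedge_list vs = 0"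
  by (induction vs) (auto simp: linear_0[OF linear_ext_of_vec] wedge_simps)

lemma ext_sign_less: "(\<And>b. b \<in> B \<Longrightarrow> i < b) \<Longrightarrow> ext_sign {i} B = 1"
proof -
  assume "\<And>b. b \<in> B \<Longrightarrow> i < b"
  then have "{(a, b). a \<in> {i} \<and> b \<in> B \<and> b < a} = {}" by fastforce
  then show ?thesis unfolding ext_sign_def by (simp only: card.empty power_0)
qed

lemma ext_sign_greater: "x < i \<Longrightarrow> ext_sign {i} {x} = -1"
proof -
  assume "x < i"
  then have "{(a, b). a \<in> {i} \<and> b \<in> {x} \<and> b < a} = {(i, x)}" by auto
  then show ?thesis unfolding ext_sign_def by simp
qed

lemma wedge_list_insort:
  fixes i :: "'n::{finite,linorder}"
  assumes "sorted xs" "distinct xs" "i \<notin> set xs"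
  shows "wedge (ext_of_vec (f i)) (wedge_list (map f xs)) =
    ext_sign {i} (set xs) *\<^sub>R wedge_list (map f (insort i xs))"
  using assms
proof (induction xs)
  case (Cons x xs)
  show ?case
  proof (cases "i \<le> x")
    case True
    then have "ext_sign {i} (set (x # xs)) = 1"
      using Cons.prems by (intro ext_sign_less) auto
    then show ?thesis using True by simp
  next
    case False
    have "ext_sign {i} (set (x # xs)) = ext_sign {i} {x} * ext_sign {i} (set xs)"
      using Cons.prems ext_sign_Un_right[of "{x}" "set xs" "{i}"] by simp
    then have *: "ext_sign {i} (insert x (set xs)) = - ext_sign {i} (set xs)"
      using False by (simp add: ext_sign_greater)
    have "wedge (ext_of_vec (f i)) (wedge_list (map f xs)) =
        ext_sign {i} (set xs) *\<^sub>R wedge_list (map f (insort i xs))"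
      using Cons by simp
    then show ?thesis
      using False wedge_vec_swap_left[of "f i" "f x" "wedge_list (map f xs)"] *
      by (simp add: wedge_simps)
  qed
qed auto

lemma wedge_list_axis:
  "wedge_list (map (\<lambda>a. axis a 1) (sorted_list_of_set A)) = axis (A :: 'n::{finite,linorder} set) 1"
proof -
  have "sorted xs \<Longrightarrow> distinct xs \<Longrightarrow>
      wedge_list (map (\<lambda>a. axis a 1) xs) = axis (set xs) 1" for xs :: "'n list"
  proof (induction xs)
    case (Cons x xs)
    then have "ext_sign {x} (set xs) = 1"
      by (intro ext_sign_less) (auto simp: order.strict_iff_order)
    then show ?case using Cons by (simp add: ext_of_vec_axis wedge_axis)
  qed auto
  from this[of "sorted_list_of_set A"] show ?thesis by simp
qed

lemma wedge_list_homogeneous: "wedge_list vs $ A \<noteq> 0 \<Longrightarrow> card A = length vs"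
proof (induction vs arbitrary: A)
  case Nil
  then show ?case by (auto simp: axis_def split: if_splits)
next
  case (Cons v vs)
  have "wedge (ext_of_vec v) (wedge_list vs) =
      (\<Sum>i\<in>UNIV. v $ i *\<^sub>R wedge (axis {i} 1) (wedge_list vs))"
    by (simp add: ext_of_vec_def wedge_simps)
  with Cons.prems obtain i where "wedge (axis {i} 1) (wedge_list vs) $ A \<noteq> 0"
    by (auto elim!: sum.not_neutral_contains_not_neutral)
  then obtain B where B: "B \<subseteq> A" "axis {i} (1::real) $ B \<noteq> 0" "wedge_list vs $ (A - B) \<noteq> 0"
    by (auto simp: wedge_def elim!: sum.not_neutral_contains_not_neutral)
  then have "B = {i}" by (auto simp: axis_def split: if_splits)
  moreover have "card (A - B) = length vs" using Cons.IH B by blast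
  ultimately show ?case using B(1) card_Suc_Diff1[of A i] by simp
qed

lemma ext_power_UNIV: "ext_power r UNIV = {x. \<forall>A. x $ A \<noteq> 0 \<longrightarrow> card A = r}"
proof
  have "subspace {x :: 'a ext. \<forall>A. x $ A \<noteq> 0 \<longrightarrow> card A = r}"
    by (auto simp: subspace_def) (metis add.right_neutral)
  then show "ext_power r UNIV \<subseteq> {x :: 'a ext. \<forall>A. x $ A \<noteq> 0 \<longrightarrow> card A = r}"
    unfolding ext_power_def by (intro span_minimal) (auto dest: wedge_list_homogeneous)
  show "{x :: 'a ext. \<forall>A. x $ A \<noteq> 0 \<longrightarrow> card A = r} \<subseteq> ext_power r UNIV"
  proof
    fix x :: "'a ext" assume x: "x \<in> {x. \<forall>A. x $ A \<noteq> 0 \<longrightarrow> card A = r}"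
    have "x $ A *\<^sub>R axis A 1 \<in> ext_power r UNIV" for A
    proof (cases "x $ A = 0")
      case True
      then show ?thesis by (simp add: ext_power_def span_zero)
    next
      case False
      with x have "card A = r" by blast
      then have "axis A 1 \<in> {wedge_list vs |vs. length vs = r \<and> set vs \<subseteq> UNIV}"
        by (auto intro!: exI[of _ "map (\<lambda>a. axis a 1) (sorted_list_of_set A)"]
            simp: wedge_list_axis)
      then show ?thesis unfolding ext_power_def by (intro span_scale span_base)
    qed
    then have "(\<Sum>A\<in>UNIV. x $ A *\<^sub>R axis A 1) \<in> ext_power r UNIV"
      unfolding ext_power_def by (intro span_sum)
    then show "x \<in> ext_power r UNIV"
      using basis_expansion[of x] by (simp add: scalar_mult_eq_scaleR)
  qed
qed

text \<open>
  \<open>ext_map L\<close> is the algebra map induced by \<open>L\<close>, and \<open>ext_proj F J\<close> fixes the ordered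
  products of columns of \<open>F\<close> with all indices in \<open>J\<close> and kills the others.
\<close>

lemma linear_ext_map: "linear (ext_map L)"
  unfolding linear_iff ext_map_def
  by (auto simp: algebra_simps sum.distrib scaleR_sum_right)

lemma ext_map_axis:
  "ext_map L (axis A 1) = wedge_list (map (\<lambda>a. L (axis a 1)) (sorted_list_of_set A))"
proof -
  have "ext_map L (axis A 1) = (\<Sum>B\<in>UNIV. if B = A
      then wedge_list (map (\<lambda>a. L (axis a 1)) (sorted_list_of_set A)) else 0)"
    unfolding ext_map_def by (intro sum.cong) (auto simp: axis_def)
  then show ?thesis by simp
qed

lemma ext_map_wedge_vec:
  assumes "linear L"
  shows "ext_map L (wedge (ext_of_vec v) x) = wedge (ext_of_vec (L v)) (ext_map L x)"
proof -
  note s = linear_add[OF linear_ext_of_vec] linear_cmul[OF linear_ext_of_vec] wedge_simps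
    linear_add[OF linear_ext_map] linear_cmul[OF linear_ext_map] linear_add[OF assms]
    linear_cmul[OF assms] linear_0[OF linear_ext_map]
  have 1: "ext_map L (wedge (ext_of_vec (axis i 1)) (axis A 1)) =
      wedge (ext_of_vec (L (axis i 1))) (ext_map L (axis A 1))" for i A
  proof (cases "i \<in> A")
    case True
    then have "wedge (ext_of_vec (L (axis i 1))) (ext_map L (axis A 1)) = 0"
      unfolding ext_map_axis by (intro wedge_list_repeat) auto
    with True show ?thesis by (simp add: ext_of_vec_axis wedge_axis s)
  next
    case False
    then show ?thesis
      using wedge_list_insort[of "sorted_list_of_set A" i "\<lambda>a. L (axis a 1)"]
      by (simp add: ext_of_vec_axis wedge_axis ext_map_axis s sorted_list_of_set_insert)
  qed
  have 2: "ext_map L (wedge (ext_of_vec (axis i 1)) x) =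
      wedge (ext_of_vec (L (axis i 1))) (ext_map L x)" for i
    by (rule linear_eq_axis[where f = "\<lambda>x. ext_map L (wedge (ext_of_vec (axis i 1)) x)"
          and g = "\<lambda>x. wedge (ext_of_vec (L (axis i 1))) (ext_map L x)", OF _ _ 1])
      (simp_all add: linear_iff s)
  show ?thesis
    by (rule linear_eq_axis[where f = "\<lambda>v. ext_map L (wedge (ext_of_vec v) x)"
          and g = "\<lambda>v. wedge (ext_of_vec (L v)) (ext_map L x)", OF _ _ 2])
      (simp_all add: linear_iff s)
qed

lemma ext_map_wedge_list: "linear L \<Longrightarrow> ext_map L (wedge_list vs) = wedge_list (map L vs)"
  by (induction vs) (auto simp: ext_map_wedge_vec ext_map_axis)

lemma linear_vec_proj: "linear (vec_proj F J)"
  unfolding linear_iff vec_proj_def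
  by (auto simp: algebra_simps sum.distrib scaleR_sum_right matrix_vector_mult_scaleR)

lemma vec_proj_column:
  assumes "invertible F"
  shows "vec_proj F J (column a F) = (if a \<in> J then column a F else 0)"
proof -
  have "matrix_inv F ** F = mat 1"
    using assms someI_ex[of "\<lambda>G. F ** G = mat 1 \<and> G ** F = mat 1"]
    by (simp add: invertible_def matrix_inv_def)
  then have "matrix_inv F *v (F *v axis a 1) = axis a 1"
    by (simp add: matrix_vector_mul_assoc)
  then have "matrix_inv F *v column a F = axis a 1"
    by (simp add: matrix_vector_mult_basis)
  then have "vec_proj F J (column a F) = (\<Sum>j\<in>J. if j = a then column a F else 0)"
    unfolding vec_proj_def by (intro sum.cong) (auto simp: axis_def)
  then show ?thesis by simp
qed

lemma ext_proj_col_wedge: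
  assumes "invertible F"
  shows "ext_proj F J (col_wedge F A) = (if A \<subseteq> J then col_wedge F A else 0)"
proof -
  have *: "ext_proj F J (col_wedge F A) =
      wedge_list (map (\<lambda>a. if a \<in> J then column a F else 0) (sorted_list_of_set A))"
    unfolding ext_proj_def col_wedge_def
    by (simp add: ext_map_wedge_list[OF linear_vec_proj] vec_proj_column[OF assms] comp_def)
  show ?thesis
  proof (cases "A \<subseteq> J")
    case True
    then have "map (\<lambda>a. if a \<in> J then column a F else 0) (sorted_list_of_set A) =
        map (\<lambda>a. column a F) (sorted_list_of_set A)"
      by auto
    with True show ?thesis unfolding * by (simp only: col_wedge_def if_True)
  next
    case False
    then show ?thesis unfolding * by (auto intro!: wedge_list_zero)
  qed
qed

end

theory Submission
  imports Defs
begin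

text \<open>
  Write \<open>n = CARD('n)\<close>, \<open>f\<^sub>A = col_wedge F A\<close>, and let \<open>D\<close> be the complement of an
  \<open>(n - d)\<close>-set \<open>J\<close>.  Wedging with \<open>f\<^sub>D\<close> kills exactly the \<open>f\<^sub>A\<close> with \<open>A\<close> not contained in
  \<open>J\<close> and maps the others to a linearly independent family.  So it has the same kernel on \<open>W\<close>
  as the projection to \<open>J\<close>, and the dimension of the projected space equals that of
  \<open>W \<and> f\<^sub>D\<close> (\<open>dim_wedge_col_wedge\<close>).  This has two consequences.

  First, \<open>w \<and> f\<^sub>D\<close> is polynomial in the entries of \<open>F\<close>, whereas the projection itself
  involves the inverse of \<open>F\<close>.  A lower bound on the rank of a polynomial family of linear maps
  is witnessed by one non-vanishing determinant, so every dimension attained by one pair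
  \<open>(J, F)\<close> is a lower bound on the non-vanishing set of a polynomial
  (\<open>ext_proj_rank_certificate\<close>).  Permuting the columns of \<open>F\<close> replaces \<open>J\<close> by any other set
  of the same size (\<open>ext_proj_relabel\<close>).  Hence the maximum \<open>m\<close> of all these dimensions is
  attained generically, for the initial segment and for every other \<open>J\<close>.  Since finitely many
  nonzero polynomials have a common non-zero (\<open>common_nonzero\<close>), a single \<open>F\<close> attains \<open>m\<close> for
  all \<open>J\<close> at once.

  Secondly, for such an \<open>F\<close> the space \<open>W \<and> \<Lambda>\<^sup>d V\<close> contains, for each \<open>d\<close>-set \<open>D\<close>, the
  \<open>m\<close>-dimensional space \<open>W \<and> f\<^sub>D\<close>.  Order the basis \<open>(f\<^sub>A)\<close> totally; a subspace has as many
  leading terms as dimensions.  The space \<open>W \<and> f\<^sub>D\<close> has \<open>m\<close> leading terms, all of them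
  \<open>(r + d)\<close>-sets containing \<open>D\<close>, and each of them is a leading term of the whole space.
  Counting pairs \<open>(D, A)\<close> as in the proof of the local LYM inequality gives
  \<open>binom n d * m \<le> dim (W \<and> \<Lambda>\<^sup>d V) * binom (r + d) d\<close> (\<open>wedge_space_growth\<close>), which is the
  inequality to be proved because
  \<open>binom n (r + d) * binom (r + d) d = binom n d * binom (n - d) r\<close>.
\<close>

section \<open>The exterior algebra under a change of basis\<close>

lemma ext_map_wedge:
  assumes "linear L"
  shows "ext_map L (wedge x y) = wedge (ext_map L x) (ext_map L y)"
proof -
  have list: "ext_map L (wedge (wedge_list vs) y) = wedge (ext_map L (wedge_list vs)) (ext_map L y)"
    for vs
    by (induction vs) (simp_all add: wedge_assoc ext_map_wedge_vec[OF assms] wedge_unit_left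
          ext_map_axis)
  show ?thesis
    by (rule linear_eq_axis[where f = "\<lambda>x. ext_map L (wedge x y)"
          and g = "\<lambda>x. wedge (ext_map L x) (ext_map L y)"])
      (simp_all add: linear_iff wedge_simps linear_add[OF linear_ext_map] linear_cmul[OF linear_ext_map]
        list flip: wedge_list_axis)
qed

lemma ext_map_compose:
  assumes "linear L" "linear M"
  shows "ext_map L (ext_map M x) = ext_map (\<lambda>v. L (M v)) x"
  by (rule linear_eq_axis[where f = "\<lambda>x. ext_map L (ext_map M x)"])
    (simp_all add: linear_iff linear_add[OF linear_ext_map] linear_cmul[OF linear_ext_map]
        ext_map_axis ext_map_wedge_list[OF assms(1)] comp_def)

lemma ext_map_ident: "ext_map (\<lambda>v. v) x = x"
  by (rule linear_eq_axis[OF linear_ext_map linear_id[unfolded id_def]])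
    (simp add: ext_map_axis wedge_list_axis)

lemma ext_map_homogeneous:
  assumes "x \<in> ext_power r UNIV"
  shows "ext_map L x \<in> ext_power r UNIV"
  unfolding ext_map_def
proof (unfold ext_power_def, intro span_sum)
  fix A :: "'a set"
  show "x $ A *\<^sub>R wedge_list (map (\<lambda>a. L (axis a 1)) (sorted_list_of_set A))
      \<in> span {wedge_list vs |vs. length vs = r \<and> set vs \<subseteq> UNIV}"
  proof (cases "x $ A = 0")
    case False
    then have "card A = r"
      using assms by (simp add: ext_power_UNIV)
    then show ?thesis
      by (intro span_scale span_base) auto
  qed (simp add: span_zero)
qed

lemma matrix_inv_mult:
  fixes F :: "'n::finite rmat"
  assumes "invertible F"
  shows "F *v (matrix_inv F *v x) = x" "matrix_inv F *v (F *v x) = x"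
  using someI_ex[OF assms[unfolded invertible_def]]
  by (simp_all add: matrix_vector_mul_assoc matrix_inv_def)

definition basis_change :: "'n rmat \<Rightarrow> 'n ext \<Rightarrow> 'n::{finite,linorder} ext" where
  "basis_change F = ext_map ((*v) F)"

lemma linear_basis_change: "linear (basis_change F)"
  unfolding basis_change_def by (rule linear_ext_map)

lemma basis_change_wedge: "basis_change F (wedge x y) = wedge (basis_change F x) (basis_change F y)"
  unfolding basis_change_def by (rule ext_map_wedge) simp

lemma basis_change_axis: "basis_change F (axis A 1) = col_wedge F A"
  by (simp add: basis_change_def ext_map_axis col_wedge_def matrix_vector_mult_basis)

lemma basis_change_inverse:
  assumes "invertible F"
  shows "basis_change F (basis_change (matrix_inv F) x) = x"
    and "basis_change (matrix_inv F) (basis_change F x) = x"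
  unfolding basis_change_def
  by (simp_all add: ext_map_compose matrix_inv_mult[OF assms] ext_map_ident)

lemma inj_basis_change: "invertible F \<Longrightarrow> inj (basis_change F)"
  by (metis basis_change_inverse(2) injI)

lemma dim_basis_change: "invertible F \<Longrightarrow> dim (basis_change F ` X) = dim X"
  by (rule dim_image_eq[OF linear_basis_change]) (meson inj_basis_change inj_on_subset subset_UNIV)

lemma basis_change_surj_image:
  assumes "invertible F"
  shows "basis_change F ` basis_change (matrix_inv F) ` X = X"
  by (simp add: image_image basis_change_inverse(1)[OF assms])

definition coord_restrict :: "'n set \<Rightarrow> 'n ext \<Rightarrow> 'n::{finite,linorder} ext" where
  "coord_restrict J x = (\<chi> A. if A \<subseteq> J then x $ A else 0)"

lemma linear_coord_restrict: "linear (coord_restrict J)"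
  by (auto simp: linear_iff coord_restrict_def vec_eq_iff)

lemma ext_proj_basis_change:
  assumes "invertible F"
  shows "ext_proj F J (basis_change F x) = basis_change F (coord_restrict J x)"
proof (rule linear_eq_axis[where f = "\<lambda>x. ext_proj F J (basis_change F x)"
      and g = "\<lambda>x. basis_change F (coord_restrict J x)"])
  show "linear (\<lambda>x. ext_proj F J (basis_change F x))"
    using linear_compose[OF linear_basis_change linear_ext_map] by (simp add: ext_proj_def comp_def)
  show "linear (\<lambda>x. basis_change F (coord_restrict J x))"
    using linear_compose[OF linear_coord_restrict linear_basis_change] by (simp add: comp_def)
  fix A :: "'a set"
  have "coord_restrict J (axis A 1) = (if A \<subseteq> J then axis A 1 else 0)"
    by (auto simp: coord_restrict_def vec_eq_iff axis_def)
  then show "ext_proj F J (basis_change F (axis A 1)) = basis_change F (coord_restrict J (axis A 1))"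
    by (simp add: basis_change_axis ext_proj_col_wedge[OF assms] linear_0[OF linear_basis_change])
qed

lemma ext_sign_nonzero [simp]: "ext_sign A B \<noteq> 0"
  by (simp add: ext_sign_def)

lemma wedge_axis_right_nth:
  "wedge x (axis D 1) $ C = (if D \<subseteq> C then ext_sign (C - D) D * x $ (C - D) else 0)"
proof -
  have "wedge x (axis D 1) $ C =
      (\<Sum>A\<in>Pow C. if A = C - D then (if D \<subseteq> C then ext_sign (C - D) D * x $ (C - D) else 0) else 0)"
    unfolding wedge_def vec_lambda_beta
    by (intro sum.cong) (auto simp: axis_def double_diff)
  then show ?thesis
    by (simp add: sum.delta)
qed

lemma wedge_axis_coord_restrict:
  "wedge (coord_restrict (- D) x) (axis D 1) = wedge x (axis D 1)"
  by (auto simp: vec_eq_iff wedge_axis_right_nth coord_restrict_def)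

lemma coord_restrict_eq_of_wedge_axis_eq:
  assumes "wedge x (axis D 1) = wedge y (axis D 1)"
  shows "coord_restrict (- D) x = coord_restrict (- D) y"
proof -
  have "x $ A = y $ A" if "A \<subseteq> - D" for A
  proof -
    have "A \<union> D - D = A"
      using that by auto
    then show ?thesis
      using arg_cong[OF assms, of "\<lambda>z. z $ (A \<union> D)"] by (simp add: wedge_axis_right_nth)
  qed
  then show ?thesis
    by (simp add: coord_restrict_def vec_eq_iff)
qed

text \<open>
  The coordinate form of the comparison of projecting with wedging: right multiplication by
  \<open>e_D\<close> factors through the coordinate projection to the subsets of \<open>- D\<close> and is injective on
  its image, because there it only relabels \<open>A\<close> as \<open>A \<union> D\<close> up to sign.
\<close>

lemma dim_wedge_axis: 
  assumes "subspace X"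
  shows "dim ((\<lambda>x. wedge x (axis D 1)) ` X) = dim (coord_restrict (- D) ` X)"
proof -
  let ?R = "coord_restrict (- D)"
  have sub: "subspace (?R ` X)"
    by (rule linear_subspace_image[OF linear_coord_restrict assms])
  have idem: "?R (?R x) = ?R x" for x :: "'a ext"
    by (simp add: coord_restrict_def vec_eq_iff)
  have "inj_on (\<lambda>x. wedge x (axis D 1)) (?R ` X)"
    by (intro inj_onI) (metis coord_restrict_eq_of_wedge_axis_eq idem imageE)
  then have "dim ((\<lambda>x. wedge x (axis D 1)) ` ?R ` X) = dim (?R ` X)"
    by (intro dim_image_eq linear_wedge_left) (simp add: span_eq_iff[THEN iffD2, OF sub])
  then show ?thesis
    by (simp add: image_image wedge_axis_coord_restrict)
qed

lemma wedge_col_wedge: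
  assumes "invertible F"
  shows "wedge w (col_wedge F D) = basis_change F (wedge (basis_change (matrix_inv F) w) (axis D 1))"
  by (simp add: basis_change_wedge basis_change_axis basis_change_inverse[OF assms])

lemma subspace_basis_change: "subspace W \<Longrightarrow> subspace (basis_change F ` W)"
  by (rule linear_subspace_image[OF linear_basis_change])

text \<open>
  The algebra automorphism \<open>basis_change F\<close> carries the standard basis to the basis \<open>(f\<^sub>A)\<close>, so
  the comparison holds in any basis.  It trades the projection, which is rational in \<open>F\<close>, for a
  product that is polynomial in \<open>F\<close> and lies in \<open>W \<and> \<Lambda>\<^sup>d V\<close>.
\<close>

lemma dim_wedge_col_wedge:
  assumes F: "invertible F" and W: "subspace W"
  shows "dim ((\<lambda>w. wedge w (col_wedge F D)) ` W) = dim (ext_proj F (- D) ` W)"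
proof -
  let ?W = "basis_change (matrix_inv F) ` W"
  have "(\<lambda>w. wedge w (col_wedge F D)) ` W = basis_change F ` (\<lambda>x. wedge x (axis D 1)) ` ?W"
    by (simp add: image_image wedge_col_wedge[OF F])
  moreover have "ext_proj F (- D) ` W = basis_change F ` coord_restrict (- D) ` ?W"
    by (subst basis_change_surj_image[OF F, of W, symmetric])
      (simp add: image_image ext_proj_basis_change[OF F])
  ultimately show ?thesis
    by (simp add: dim_basis_change[OF F] dim_wedge_axis subspace_basis_change W)
qed

section \<open>Relabelling the columns\<close>

lemma vec_proj_permute_columns:
  fixes F F' :: "'n::finite rmat"
  assumes F: "invertible F" and F': "invertible F'"
    and col: "\<And>a. column a F' = column (\<sigma> a) F" and J: "\<And>a. a \<in> J' \<longleftrightarrow> \<sigma> a \<in> J"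
  shows "vec_proj F' J' = vec_proj F J"
proof
  fix v
  have eq: "vec_proj F' J' (column a F') = vec_proj F J (column a F')" for a
    using vec_proj_column[OF F', of J' a] vec_proj_column[OF F, of J "\<sigma> a"] by (simp add: col J)
  have v: "v = (\<Sum>a\<in>UNIV. (matrix_inv F' *v v) $ a *\<^sub>R column a F')"
    using matrix_inv_mult(1)[OF F', of v]
    by (simp add: matrix_mult_sum scalar_mult_eq_scaleR)
  show "vec_proj F' J' v = vec_proj F J v"
    by (subst (1 2) v) (simp add: linear_sum[OF linear_vec_proj] linear_cmul[OF linear_vec_proj] eq)
qed

text \<open>
  Permuting the columns by a bijection that carries \<open>J'\<close> to \<open>J\<close> leaves both the kernel and the
  image of the projection unchanged.  Thus the maximum over all index sets is already the
  maximum for each single one of them.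
\<close>

lemma ext_proj_relabel:
  fixes F :: "'n::{finite,linorder} rmat"
  assumes F: "invertible F" and card: "card J = card J'"
  obtains F' where "invertible F'" "ext_proj F' J' = ext_proj F J"
proof -
  have "card (- J) = card (- J')"
    by (simp add: Compl_eq_Diff_UNIV card_Diff_subset card)
  then obtain f g where f: "bij_betw f J' J" and g: "bij_betw g (- J') (- J)"
    by (metis card finite finite_same_card_bij)
  define \<sigma> where "\<sigma> a = (if a \<in> J' then f a else g a)" for a
  have "bij_betw \<sigma> (J' \<union> - J') (J \<union> - J)"
  proof (rule bij_betw_combine)
    show "bij_betw \<sigma> J' J" "bij_betw \<sigma> (- J') (- J)"
      using f g bij_betw_cong[of J' \<sigma> f J] bij_betw_cong[of "- J'" \<sigma> g "- J"]
      by (simp_all add: \<sigma>_def)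
  qed simp
  then have perm: "\<sigma> permutes UNIV"
    by (intro bij_imp_permutes) simp_all
  define F' :: "'n rmat" where "F' = (\<chi> i j. F $ i $ \<sigma> j)"
  have "invertible F'"
    using F det_permute_columns[OF perm, of F] by (simp add: invertible_det_nz F'_def)
  moreover have "column a F' = column (\<sigma> a) F" for a
    by (simp add: column_def F'_def)
  moreover have "a \<in> J' \<longleftrightarrow> \<sigma> a \<in> J" for a
    using f g by (auto simp: \<sigma>_def bij_betw_def)
  ultimately have "vec_proj F' J' = vec_proj F J"
    by (intro vec_proj_permute_columns F)
  with \<open>invertible F'\<close> show thesis
    by (intro that[of F']) (simp_all add: ext_proj_def)
qed

section \<open>Rank is bounded below on a Zariski open set\<close>

lemma dim_range_plus_dim_kernel:
  fixes L :: "'a::euclidean_space \<Rightarrow> 'b::euclidean_space"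
  assumes L: "linear L"
  shows "dim (range L) + dim {x. L x = 0} = DIM('a)"
proof -
  obtain g where g: "linear g" "\<And>y. y \<in> range L \<Longrightarrow> L (g y) = y"
    using linear_exists_right_inverse_on[OF L subspace_UNIV] by auto
  have R: "subspace (range L)" and K: "subspace {x. L x = 0}"
    using linear_subspace_image[OF L subspace_UNIV] linear_subspace_kernel[OF L] by auto
  have "{x + y |x y. x \<in> g ` range L \<and> y \<in> {x. L x = 0}} = UNIV"
  proof -
    have "x = g (L x) + (x - g (L x)) \<and> L (x - g (L x)) = 0" for x
      by (simp add: linear_diff[OF L] g(2))
    then show ?thesis
      by blast
  qed
  moreover have "g ` range L \<inter> {x. L x = 0} = {0}"
  proof -
    have "g y = 0" if "y \<in> range L" "L (g y) = 0" for y
      using that by (simp add: g(2) linear_0[OF g(1)])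
    moreover have "0 \<in> g ` range L"
      using linear_0[OF L] linear_0[OF g(1)] by (metis image_eqI rangeI)
    ultimately show ?thesis
      using linear_0[OF L] by auto
  qed
  moreover have "dim (g ` range L) = dim (range L)"
    by (rule dim_image_eq[OF g(1)]) (simp add: span_eq_iff[THEN iffD2, OF R], metis g(2) inj_onI)
  ultimately show ?thesis
    using dim_sums_Int[OF linear_subspace_image[OF g(1) R] K] by simp
qed

text \<open>
  A map of rank \<open>k\<close> becomes injective after adding a suitable map of complementary rank: one
  that sends the kernel isomorphically onto the orthogonal complement of the range.  Conversely
  (\<open>dim_ranges_of_inj_sum\<close>) a map of rank below \<open>k\<close> does not become injective by adding a map
  of that complementary rank.  This replaces minors of varying size by a single determinant of fixed size.
\<close>

lemma complementary_rank_correction: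
  fixes L :: "'a::euclidean_space \<Rightarrow> 'a"
  assumes L: "linear L"
  obtains C where "linear C" "inj (\<lambda>x. L x + C x)" "dim (range L) + dim (range C) = DIM('a)"
proof -
  let ?K = "{x. L x = 0}" and ?Q = "{y. \<forall>x\<in>range L. orthogonal x y}"
  have R: "subspace (range L)" and K: "subspace ?K"
    using linear_subspace_image[OF L subspace_UNIV] linear_subspace_kernel[OF L] by auto
  have Q: "subspace ?Q"
    by (rule subspace_orthogonal_to_vectors)
  have dim_Q: "dim ?Q + dim (range L) = DIM('a)"
    using dim_subspace_orthogonal_to_vectors[OF R subspace_UNIV] by simp
  obtain B where B: "B \<subseteq> ?K" "independent B" "?K \<subseteq> span B" "card B = dim ?K"
    using basis_exists by blast
  obtain B' where B': "B' \<subseteq> ?Q" "independent B'" "?Q \<subseteq> span B'" "card B' = dim ?Q"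
    using basis_exists by blast
  have "card B = card B'"
    using B(4) B'(4) dim_Q dim_range_plus_dim_kernel[OF L] by simp
  then obtain f where f: "bij_betw f B B'"
    using B(2) B'(2) finite_same_card_bij finiteI_independent by metis
  obtain C where C: "linear C" "\<And>x. x \<in> B \<Longrightarrow> C x = f x" "range C = span (f ` B)"
    using linear_independent_extend_subspace[OF B(2), of f] by blast
  have fB: "f ` B = B'"
    using f by (simp add: bij_betw_def)
  have CB: "C ` B = B'"
    using C(2) fB by force
  have range_C: "range C = ?Q"
    using C(3) fB B'(1,3) span_minimal[OF B'(1) Q] by auto
  have "inj_on C B"
    using f C(2) by (simp add: bij_betw_def inj_on_def)
  then have "inj_on C (span B)"
    using linear_inj_on_span_independent_image[OF C(1)] B'(2) CB by auto
  then have inj: "inj_on C ?K"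
    by (rule inj_on_subset[OF _ B(3)])
  have LC: "linear (\<lambda>x. L x + C x)"
    by (rule linear_compose_add[OF L C(1)])
  have "x = 0" if "L x + C x = 0" for x
  proof -
    have "orthogonal (L x) (C x)"
      using range_C by blast
    then have "L x = 0 \<and> C x = 0"
      using eq_neg_iff_add_eq_0[of "L x" "C x"] that by (simp add: orthogonal_def)
    then show ?thesis
      using inj_onD[OF inj, of x 0] by (simp add: linear_0[OF L] linear_0[OF C(1)])
  qed
  then have "inj (\<lambda>x. L x + C x)"
    unfolding linear_injective_0[OF LC] by blast
  then show thesis
    using C(1) dim_Q range_C by (intro that[of C]) auto
qed

lemma dim_ranges_of_inj_sum:
  fixes L C :: "'a::euclidean_space \<Rightarrow> 'a"
  assumes "linear L" "linear C" "inj (\<lambda>x. L x + C x)"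
  shows "DIM('a) \<le> dim (range L) + dim (range C)"
proof -
  have LC: "linear (\<lambda>x. L x + C x)"
    by (rule linear_compose_add[OF assms(1,2)])
  have "surj (\<lambda>x. L x + C x)"
    by (rule linear_injective_imp_surjective[OF LC assms(3) refl])
  have "y \<in> {x + y |x y. x \<in> range L \<and> y \<in> range C}" for y
  proof -
    obtain x where "y = L x + C x"
      using surjD[OF \<open>surj (\<lambda>x. L x + C x)\<close>] by blast
    then show ?thesis
      by blast
  qed
  then have "{x + y |x y. x \<in> range L \<and> y \<in> range C} = UNIV"
    by blast
  then show ?thesis
    using dim_sums_Int[OF linear_subspace_image[OF assms(1) subspace_UNIV]
        linear_subspace_image[OF assms(2) subspace_UNIV]]
    by simp
qed

lemmas real_polynomial_linear = real_polynomial_function.intros(1)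
  and real_polynomial_const = real_polynomial_function.intros(2)
  and real_polynomial_mult = real_polynomial_function.intros(4)

lemma real_polynomial_function_det:
  fixes M :: "'a::real_normed_vector \<Rightarrow> real^'n^'n"
  assumes "\<And>i j. real_polynomial_function (\<lambda>a. M a $ i $ j)"
  shows "real_polynomial_function (\<lambda>a. det (M a))"
  unfolding det_def
  by (intro real_polynomial_function_sum real_polynomial_mult real_polynomial_const
      real_polynomial_function_prod assms) (auto intro: finite_permutations)

text \<open>
  Lower semicontinuity of the rank in the Zariski topology.  With \<open>C\<close> of complementary rank
  chosen for the map at \<open>a0\<close>, the polynomial is \<open>a \<mapsto> det (L a + C)\<close>.
\<close>

lemma rank_lower_bound_certificate:
  fixes L :: "'a::real_normed_vector \<Rightarrow> real^'i \<Rightarrow> real^'i"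
  assumes L: "\<And>a. linear (L a)" and poly: "\<And>x i. real_polynomial_function (\<lambda>a. L a x $ i)"
  obtains q where "real_polynomial_function q" "q a0 \<noteq> 0"
    "\<And>a. q a \<noteq> 0 \<Longrightarrow> dim (range (L a0)) \<le> dim (range (L a))"
proof -
  obtain C where C: "linear C" "inj (\<lambda>x. L a0 x + C x)"
      "dim (range (L a0)) + dim (range C) = DIM(real^'i)"
    using complementary_rank_correction[OF L] by blast
  define q where "q a = det (matrix (\<lambda>x. L a x + C x))" for a
  have q_nz: "q a \<noteq> 0 \<longleftrightarrow> inj (\<lambda>x. L a x + C x)" for a
    unfolding q_def by (rule det_nz_iff_inj[OF linear_compose_add[OF L C(1)]])
  show thesis
  proof
    show "real_polynomial_function q"
      unfolding q_def
      by (intro real_polynomial_function_det) (auto simp: matrix_def intro!: poly)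
    show "q a0 \<noteq> 0"
      using C(2) q_nz by simp
    show "dim (range (L a0)) \<le> dim (range (L a))" if "q a \<noteq> 0" for a
      using dim_ranges_of_inj_sum[OF L C(1), of a] that q_nz[of a] C(3) by simp
  qed
qed

text \<open>
  A real normed space is irreducible in the Zariski topology: on the line through a non-zero of \<open>p\<close> and a non-zero of
  \<open>q\<close> both restrict to nonzero polynomials in one variable, with finitely many roots each.
\<close>

lemma common_nonzero_two:
  fixes p q :: "'a::real_normed_vector \<Rightarrow> real"
  assumes p: "real_polynomial_function p" "p a \<noteq> 0" and q: "real_polynomial_function q" "q b \<noteq> 0"
  obtains x where "p x \<noteq> 0" "q x \<noteq> 0"
proof -
  define l where "l t = a + t *\<^sub>R (b - a)" for t :: real
  have "polynomial_function l"
    unfolding l_def by (intro polynomial_function_add polynomial_function_const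
        polynomial_function_bounded_linear bounded_linear_scaleR_left)
  then have l: "real_polynomial_function (f \<circ> l)" if "real_polynomial_function f" for f
    using that by (rule real_polynomial_function_compose)
  have fin: "finite {t. (f \<circ> l) t = 0}"
    if "real_polynomial_function f" "f (l s) \<noteq> 0" for f s
  proof -
    from l[OF that(1)] obtain c n where c: "f \<circ> l = (\<lambda>t. \<Sum>i\<le>n. c i * t ^ i)"
      by (auto simp: real_polynomial_function_iff_sum)
    have "\<exists>i\<le>n. c i \<noteq> 0"
    proof (rule ccontr)
      assume "\<not> ?thesis"
      then have "(f \<circ> l) s = 0"
        unfolding c by simp
      with that(2) show False
        by simp
    qed
    then show ?thesis
      unfolding c by (simp add: polyfun_finite_roots)
  qed
  have "l 0 = a" "l 1 = b"
    by (simp_all add: l_def)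
  then have "finite ({t. (p \<circ> l) t = 0} \<union> {t. (q \<circ> l) t = 0})"
    using fin[OF p(1), of 0] fin[OF q(1), of 1] p(2) q(2) by simp
  then obtain t where "t \<notin> {t. (p \<circ> l) t = 0} \<union> {t. (q \<circ> l) t = 0}"
    using ex_new_if_finite[OF infinite_UNIV_char_0] by blast
  then show thesis
    by (intro that[of "l t"]) auto
qed

lemma common_nonzero:
  fixes p :: "'i \<Rightarrow> 'a::real_normed_vector \<Rightarrow> real"
  assumes "finite I" "\<And>i. i \<in> I \<Longrightarrow> real_polynomial_function (p i)"
    and "\<And>i. i \<in> I \<Longrightarrow> \<exists>x. p i x \<noteq> 0"
  obtains x where "\<And>i. i \<in> I \<Longrightarrow> p i x \<noteq> 0"
proof -
  have "\<exists>x. \<forall>i\<in>I. p i x \<noteq> 0"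
    using assms
  proof (induction I)
    case (insert i I)
    then obtain a where a: "\<forall>j\<in>I. p j a \<noteq> 0"
      by auto
    obtain b where b: "p i b \<noteq> 0"
      using insert.prems by auto
    have "real_polynomial_function (\<lambda>x. \<Prod>j\<in>I. p j x)"
      using insert by (intro real_polynomial_function_prod) auto
    moreover have "(\<Prod>j\<in>I. p j a) \<noteq> 0"
      using a insert.hyps by simp
    ultimately obtain x where "(\<Prod>j\<in>I. p j x) \<noteq> 0" "p i x \<noteq> 0"
      using common_nonzero_two[of "\<lambda>x. \<Prod>j\<in>I. p j x" a "p i" b] insert.prems b by auto
    then show ?case
      using insert.hyps by auto
  qed simp
  then show thesis
    using that by blast
qed

section \<open>Generic maximality of projections\<close>

lemma real_polynomial_function_entry:
  "real_polynomial_function (\<lambda>F :: real^'n^'m. F $ i $ j)"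
  by (intro real_polynomial_linear
      bounded_linear_compose[OF bounded_linear_vec_nth bounded_linear_vec_nth])

lemma real_polynomial_function_wedge:
  fixes f g :: "'a::real_normed_vector \<Rightarrow> 'n::{finite,linorder} ext"
  assumes "\<And>A. real_polynomial_function (\<lambda>a. f a $ A)" "\<And>A. real_polynomial_function (\<lambda>a. g a $ A)"
  shows "real_polynomial_function (\<lambda>a. wedge (f a) (g a) $ C)"
  unfolding wedge_def vec_lambda_beta
  by (intro real_polynomial_function_sum real_polynomial_mult real_polynomial_const
      assms) auto

lemma real_polynomial_function_col_wedge:
  "real_polynomial_function (\<lambda>F :: 'n::{finite,linorder} rmat. col_wedge F D $ A)"
proof -
  have ext: "real_polynomial_function (\<lambda>F :: 'n rmat. ext_of_vec (column i F) $ A)" for i A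
    by (auto simp: ext_of_vec_def column_def
        intro!: real_polynomial_function_sum real_polynomial_mult
        real_polynomial_const real_polynomial_function_entry)
  have "real_polynomial_function (\<lambda>F :: 'n rmat. wedge_list (map (\<lambda>i. column i F) is) $ A)" for "is" A
    by (induction "is" arbitrary: A)
      (auto intro!: real_polynomial_function_wedge ext)
  then show ?thesis
    by (simp add: col_wedge_def)
qed

text \<open>
  To apply the rank certificate to the space \<open>W \<and> f\<^sub>D\<close>, it is written as the range of an
  endomorphism of the whole exterior algebra, by precomposing with a fixed linear map \<open>P\<close>
  onto \<open>W\<close>.
\<close>

lemma ext_proj_rank_certificate:
  fixes W :: "'n::{finite,linorder} ext set"
  assumes W: "subspace W" and F0: "invertible F0"
  obtains q where "real_polynomial_function q" "q F0 \<noteq> 0"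
    "\<And>F. invertible F \<Longrightarrow> q F \<noteq> 0 \<Longrightarrow> dim (ext_proj F0 J ` W) \<le> dim (ext_proj F J ` W)"
proof -
  obtain B where B: "B \<subseteq> W" "independent B" "W \<subseteq> span B"
    by (metis basis_exists)
  obtain P :: "'n ext \<Rightarrow> 'n ext" where P: "linear P" "range P = span (id ` B)"
    using linear_independent_extend_subspace[OF B(2), of "id :: 'n ext \<Rightarrow> 'n ext"] by blast
  then have range_P: "range P = W"
    using B(3) span_minimal[OF B(1) W] by auto
  define L where "L F x = wedge (P x) (col_wedge F (- J))" for F x
  have range_L: "dim (range (L F)) = dim (ext_proj F J ` W)" if "invertible F" for F
  proof -
    have "range (L F) = (\<lambda>w. wedge w (col_wedge F (- J))) ` W"
      by (simp add: L_def image_image flip: range_P)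
    then show ?thesis
      using dim_wedge_col_wedge[OF that W, of "- J"] by simp
  qed
  have "linear (L F)" for F
    using linear_compose[OF P(1) linear_wedge_left, of "col_wedge F (- J)"]
    by (simp add: L_def[abs_def] comp_def)
  moreover have "real_polynomial_function (\<lambda>F. L F x $ A)" for x A
    unfolding L_def
    by (intro real_polynomial_function_wedge real_polynomial_function_col_wedge
        real_polynomial_const)
  ultimately obtain q where "real_polynomial_function q" "q F0 \<noteq> 0"
      "\<And>F. q F \<noteq> 0 \<Longrightarrow> dim (range (L F0)) \<le> dim (range (L F))"
    using rank_lower_bound_certificate[of L F0] by blast
  then show thesis
    using range_L[OF F0] range_L by (intro that[of q]) metis+
qed

section \<open>Leading terms\<close>

text \<open>
  The total order on the basis is given by a ranking \<open>\<rho>\<close> into the natural numbers, since the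
  index type of the exterior algebra, a type of sets, is not linearly ordered by inclusion.
\<close>

definition leading_terms :: "('i \<Rightarrow> nat) \<Rightarrow> (real^'i) set \<Rightarrow> 'i::finite set" where
  "leading_terms \<rho> U = {A. \<exists>u\<in>U. u $ A \<noteq> 0 \<and> (\<forall>B. u $ B \<noteq> 0 \<longrightarrow> \<rho> B \<le> \<rho> A)}"

text \<open>
  Vectors with pairwise different leading terms are independent: adding them in increasing order,
  the coordinate at each new leading term vanishes on the span of the earlier vectors.
\<close>

lemma card_leading_terms_le_dim:
  assumes \<rho>: "inj \<rho>"
  shows "card (leading_terms \<rho> U) \<le> dim U"
proof -
  let ?S = "leading_terms \<rho> U"
  have "\<exists>u. \<forall>A\<in>?S. u A \<in> U \<and> u A $ A \<noteq> 0 \<and> (\<forall>B. u A $ B \<noteq> 0 \<longrightarrow> \<rho> B \<le> \<rho> A)"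
    by (rule bchoice) (auto simp: leading_terms_def)
  then obtain u where u: "\<And>A. A \<in> ?S \<Longrightarrow> u A \<in> U" "\<And>A. A \<in> ?S \<Longrightarrow> u A $ A \<noteq> 0"
      "\<And>A B. A \<in> ?S \<Longrightarrow> u A $ B \<noteq> 0 \<Longrightarrow> \<rho> B \<le> \<rho> A"
    by blast
  have "finite ?S"
    by simp
  then have "?S \<subseteq> ?S \<longrightarrow> independent (u ` ?S) \<and> card (u ` ?S) = card ?S"
  proof (induct rule: finite_ranking_induct[where f = \<rho> and S = "?S"
        and P = "\<lambda>T. T \<subseteq> ?S \<longrightarrow> independent (u ` T) \<and> card (u ` T) = card T"])
    case (insert A T)
    show ?case
    proof (cases "A \<in> T")
      case True
      then show ?thesis
        using insert.hyps(3) by (simp add: insert_absorb)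
    next
      case False
      show ?thesis
      proof
        assume sub: "insert A T \<subseteq> ?S"
        have "u B $ A = 0" if "B \<in> T" for B
        proof (rule ccontr)
          assume "u B $ A \<noteq> 0"
          then have "\<rho> A \<le> \<rho> B"
            using u(3) sub that by blast
          then have "\<rho> A = \<rho> B"
            using insert.hyps(2)[OF that] by simp
          then show False
            using injD[OF \<rho>] False that by metis
        qed
        then have "span (u ` T) \<subseteq> {v. v $ A = 0}"
          by (intro span_minimal) (auto simp: subspace_def)
        then have notin: "u A \<notin> span (u ` T)"
          using u(2)[of A] sub by blast
        then have "u A \<notin> u ` T"
          using span_base[of "u A" "u ` T"] by blast
        with notin show "independent (u ` insert A T) \<and> card (u ` insert A T) = card (insert A T)"
          using insert.hyps(3) sub insert.hyps(1) False by (simp add: independent_insert)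
      qed
    qed
  qed (simp add: independent_empty)
  then have "independent (u ` ?S)" "card (u ` ?S) = card ?S"
    by simp_all
  moreover have "u ` ?S \<subseteq> U"
    using u(1) by blast
  ultimately show ?thesis
    using independent_card_le_dim by metis
qed

text \<open>
  Forgetting all coordinates outside the leading terms is injective on \<open>U\<close>, because a nonzero
  vector keeps its own leading coordinate.
\<close>

lemma dim_le_card_leading_terms:
  assumes U: "subspace U"
  shows "dim U \<le> card (leading_terms \<rho> U)"
proof -
  let ?S = "leading_terms \<rho> U"
  define R :: "real^'a \<Rightarrow> real^'a" where "R u = (\<chi> A. if A \<in> ?S then u $ A else 0)" for u
  have R: "linear R"
    by (auto simp: linear_iff R_def vec_eq_iff)
  have "u = 0" if "u \<in> U" "R u = 0" for u
  proof (rule ccontr)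
    assume "u \<noteq> 0"
    then have "{A. u $ A \<noteq> 0} \<noteq> {}"
      by (auto simp: vec_eq_iff)
    then have "Max (\<rho> ` {A. u $ A \<noteq> 0}) \<in> \<rho> ` {A. u $ A \<noteq> 0}"
      by (intro Max_in) auto
    then obtain A where A: "u $ A \<noteq> 0" "\<rho> A = Max (\<rho> ` {A. u $ A \<noteq> 0})"
      by auto
    have "\<rho> B \<le> \<rho> A" if "u $ B \<noteq> 0" for B
      unfolding A(2) using that by (intro Max_ge) auto
    then have "A \<in> ?S"
      using \<open>u \<in> U\<close> A(1) unfolding leading_terms_def by blast
    then have "R u $ A = u $ A"
      by (simp add: R_def)
    then show False
      using \<open>R u = 0\<close> A(1) by simp
  qed
  then have "inj_on R U"
    unfolding linear_inj_on_iff_eq_0[OF R U] by blast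
  then have "dim U = dim (R ` U)"
    by (simp add: dim_image_eq[OF R] span_eq_iff[THEN iffD2, OF U])
  also have "\<dots> \<le> card ((\<lambda>A. axis A (1::real)) ` ?S)"
  proof (rule dim_le_card)
    show "R ` U \<subseteq> span ((\<lambda>A. axis A 1) ` ?S)"
    proof
      fix v assume "v \<in> R ` U"
      then have v: "v $ A = 0" if "A \<notin> ?S" for A
        using that by (auto simp: R_def)
      have "v = (\<Sum>A\<in>UNIV. v $ A *\<^sub>R axis A 1)"
        using basis_expansion[of v] by (simp add: scalar_mult_eq_scaleR)
      also have "\<dots> = (\<Sum>A\<in>?S. v $ A *\<^sub>R axis A 1)"
        by (rule sum.mono_neutral_right) (auto simp: v)
      also have "\<dots> \<in> span ((\<lambda>A. axis A 1) ` ?S)"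
        by (intro span_sum span_scale span_base) auto
      finally show "v \<in> span ((\<lambda>A. axis A 1) ` ?S)" .
    qed
  qed simp
  also have "\<dots> \<le> card ?S"
    by (rule card_image_le) simp
  finally show ?thesis .
qed

section \<open>Double counting\<close>

text \<open>
  Both sides bound the number of pairs \<open>(D, A)\<close> with \<open>A \<in> X D\<close>: each \<open>D\<close> has at least \<open>m\<close>
  partners, and each \<open>A\<close> has at most as many partners as it has \<open>d\<close>-subsets.
\<close>

lemma double_count_local_LYM:
  fixes Y :: "'n::finite set set" and X :: "'n set \<Rightarrow> 'n set set"
  assumes X: "\<And>D A. card D = d \<Longrightarrow> A \<in> X D \<Longrightarrow> A \<in> Y \<and> D \<subseteq> A \<and> card A = k"
    and m: "\<And>D. card D = d \<Longrightarrow> m \<le> card (X D)"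
  shows "(CARD('n) choose d) * m \<le> card Y * (k choose d)"
proof -
  let ?D = "{D :: 'n set. card D = d}" and ?Y = "{A \<in> Y. card A = k}"
  have card_D: "card ?D = CARD('n) choose d"
    using n_subsets[of "UNIV :: 'n set" d] by simp
  have card_sub: "card {D. D \<subseteq> A \<and> card D = d} = k choose d" if "card A = k" for A :: "'n set"
    using n_subsets[of A d] that by simp
  have "card ?D * m \<le> (\<Sum>D\<in>?D. card (X D))"
    using sum_mono[of ?D "\<lambda>_. m" "\<lambda>D. card (X D)"] m by simp
  also have "\<dots> = card (SIGMA D:?D. X D)"
    by (simp add: card_SigmaI)
  also have "\<dots> = card (prod.swap ` (SIGMA D:?D. X D))"
    by (simp add: card_image)
  also have "\<dots> \<le> card (SIGMA A:?Y. {D. D \<subseteq> A \<and> card D = d})"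
  proof (intro card_mono subsetI)
    fix p assume "p \<in> prod.swap ` (SIGMA D:?D. X D)"
    then obtain D A where "p = (A, D)" "card D = d" "A \<in> X D"
      by auto
    then show "p \<in> (SIGMA A:?Y. {D. D \<subseteq> A \<and> card D = d})"
      using X[of D A] by simp
  qed simp
  also have "\<dots> = card ?Y * (k choose d)"
    by (simp add: card_SigmaI card_sub)
  also have "\<dots> \<le> card Y * (k choose d)"
    by (intro mult_right_mono card_mono) auto
  finally show ?thesis
    by (simp add: card_D)
qed

text \<open>
  Everything is transported by \<open>\<Phi>\<close>, the inverse of \<open>basis_change F\<close>, to the standard basis.  There
  each \<open>W \<and> f\<^sub>D\<close> becomes a product with \<open>e_D\<close>, so that all its leading terms contain \<open>D\<close>, while
  the leading terms for all \<open>D\<close> together are among those of one space of dimension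
  \<open>dim (W \<and> \<Lambda>\<^sup>d V)\<close>.
\<close>

lemma wedge_space_growth:
  fixes W :: "'n::{finite,linorder} ext set"
  assumes W: "subspace W" "W \<subseteq> ext_power r UNIV" and F: "invertible F"
    and m: "\<And>D. card D = d \<Longrightarrow> m \<le> dim (ext_proj F (- D) ` W)"
  shows "(CARD('n) choose d) * m \<le> dim (wedge_space W (ext_power d UNIV)) * ((r + d) choose d)"
proof -
  let ?U = "wedge_space W (ext_power d UNIV)" and ?\<Phi> = "basis_change (matrix_inv F)"
  let ?WD = "\<lambda>D. (\<lambda>x. wedge x (axis D 1)) ` ?\<Phi> ` W"
  obtain \<rho> :: "'n set \<Rightarrow> nat" where \<rho>: "inj \<rho>"
    using finite_imp_inj_to_nat_seg[of "UNIV :: 'n set set"] by auto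
  have sub: "subspace (?WD D)" for D
    by (intro linear_subspace_image[OF linear_wedge_left] subspace_basis_change W(1))
  have WD_U: "?WD D \<subseteq> ?\<Phi> ` ?U" if D: "card D = d" for D
  proof
    fix y assume "y \<in> ?WD D"
    then obtain w where w: "w \<in> W" "y = wedge (?\<Phi> w) (axis D 1)"
      by blast
    have "col_wedge F D \<in> ext_power d UNIV"
      unfolding col_wedge_def ext_power_def using D by (intro span_base) auto
    then have "wedge w (col_wedge F D) \<in> ?U"
      unfolding wedge_space_def using w(1) by (intro span_base) auto
    moreover have "y = ?\<Phi> (wedge w (col_wedge F D))"
      by (simp add: w(2) wedge_col_wedge[OF F] basis_change_inverse[OF F])
    ultimately show "y \<in> ?\<Phi> ` ?U"
      by blast
  qed
  have "(CARD('n) choose d) * m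
      \<le> card (leading_terms \<rho> (?\<Phi> ` ?U)) * ((r + d) choose d)"
  proof (rule double_count_local_LYM[where X = "\<lambda>D. leading_terms \<rho> (?WD D)"])
    fix D A :: "'n set" assume D: "card D = d" and A: "A \<in> leading_terms \<rho> (?WD D)"
    then obtain w where w: "w \<in> W" "wedge (?\<Phi> w) (axis D 1) $ A \<noteq> 0"
      by (auto simp: leading_terms_def)
    then have DA: "D \<subseteq> A" and nz: "?\<Phi> w $ (A - D) \<noteq> 0"
      by (auto simp: wedge_axis_right_nth split: if_splits)
    have "?\<Phi> w \<in> ext_power r UNIV"
      unfolding basis_change_def using w(1) W(2) by (intro ext_map_homogeneous) auto
    then have "card (A - D) = r"
      using nz by (simp add: ext_power_UNIV)
    then have "card A = r + d"
      using DA D by (metis card_Diff_subset card_mono finite le_add_diff_inverse2)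
    moreover have "A \<in> leading_terms \<rho> (?\<Phi> ` ?U)"
      using A WD_U[OF D] unfolding leading_terms_def by blast
    ultimately show "A \<in> leading_terms \<rho> (?\<Phi> ` ?U) \<and> D \<subseteq> A \<and> card A = r + d"
      using DA by simp
  next
    fix D :: "'n set" assume D: "card D = d"
    have "m \<le> dim (ext_proj F (- D) ` W)"
      by (rule m[OF D])
    also have "\<dots> = dim (basis_change F ` ?WD D)"
      by (simp add: wedge_col_wedge[OF F] image_image flip: dim_wedge_col_wedge[OF F W(1)])
    also have "\<dots> = dim (?WD D)"
      by (rule dim_basis_change[OF F])
    also have "\<dots> \<le> card (leading_terms \<rho> (?WD D))"
      by (rule dim_le_card_leading_terms[OF sub])
    finally show "m \<le> card (leading_terms \<rho> (?WD D))" .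
  qed
  also have "card (leading_terms \<rho> (?\<Phi> ` ?U)) \<le> dim ?U"
    using card_leading_terms_le_dim[OF \<rho>, of "?\<Phi> ` ?U"] dim_image_le[OF linear_basis_change] order_trans
    by blast
  finally show ?thesis
    by simp
qed

section \<open>The normalised dimension inequality\<close>

lemma card_first_indices:
  assumes "k \<le> CARD('n::{finite,linorder})"
  shows "card (first_indices k :: 'n set) = k"
proof -
  define p where "p j = card {i. i \<le> j}" for j :: 'n
  have less: "p i < p j" if "i < j" for i j
    unfolding p_def
  proof (rule psubset_card_mono)
    have "j \<in> {k. k \<le> j} - {k. k \<le> i}"
      using that by simp
    then show "{k. k \<le> i} \<subset> {k. k \<le> j}"
      using that by (intro psubsetI) auto
  qed simp
  have "inj p"
    by (rule injI) (metis less less_irrefl linorder_neqE)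
  have "p j \<in> {1..CARD('n)}" for j
    by (auto simp: p_def Suc_le_eq card_gt_0_iff intro!: card_mono)
  then have "range p = {1..CARD('n)}"
    by (intro card_subset_eq) (auto simp: card_image[OF \<open>inj p\<close>])
  then have "p ` {j. p j \<le> k} = {1..k}"
    using assms by (auto simp: set_eq_iff image_iff) (metis Suc_leI le_trans)
  then have "p ` first_indices k = {1..k}"
    by (simp add: first_indices_def p_def)
  then show ?thesis
    using card_image[OF inj_on_subset[OF \<open>inj p\<close>], of "first_indices k"] by simp
qed

theorem corollary3p7:
  fixes W :: "'n::{finite,linorder} ext set" and r d :: nat
  assumes "0 < r" and "r < r + d" and "r + d \<le> CARD('n)"
    and "subspace W" and "W \<subseteq> ext_power r UNIV"
  shows "\<exists>U :: 'n rmat set. zariski_open_in_GL U \<and> U \<noteq> {} \<and>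
    (\<forall>F\<in>U.
      real (dim (wedge_space W (ext_power d UNIV))) / real (CARD('n) choose (r + d))
        \<ge> real (dim (ext_proj F (first_indices (CARD('n) - d)) ` W))
            / real ((CARD('n) - d) choose r)
      \<and> real (dim (ext_proj F (first_indices (CARD('n) - d)) ` W))
            / real ((CARD('n) - d) choose r)
        = Max {real (dim (ext_proj F' J ` W)) / real ((CARD('n) - d) choose r) |J F'.
                 card J = CARD('n) - d \<and> F' \<in> general_linear})"
proof -
  let ?n = "CARD('n)"
  let ?J0 = "first_indices (?n - d) :: 'n set"
  let ?adm = "\<lambda>J (F :: 'n rmat). card J = ?n - d \<and> invertible F"
  define dims where "dims = {dim (ext_proj F J ` W) |J F. ?adm J F}"
  define m where "m = Max dims"
  have card_J0: "card ?J0 = ?n - d"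
    by (rule card_first_indices) simp
  have inv1: "invertible (mat 1 :: 'n rmat)"
    by (simp add: invertible_det_nz)
  have "dims \<subseteq> {..dim (UNIV :: 'n ext set)}"
    using dim_subset[OF subset_UNIV] unfolding dims_def by blast
  then have fin: "finite dims"
    by (rule finite_subset) simp
  have "dim (ext_proj (mat 1) ?J0 ` W) \<in> dims"
    using card_J0 inv1 unfolding dims_def by blast
  then have "m \<in> dims"
    unfolding m_def by (intro Max_in fin) auto
  then obtain J1 F1 where 1: "m = dim (ext_proj F1 J1 ` W)" "card J1 = ?n - d" "invertible F1"
    unfolding dims_def by blast
  have le_m: "dim (ext_proj F J ` W) \<le> m" if "?adm J F" for J F
    unfolding m_def using that by (intro Max_ge fin) (auto simp: dims_def)
  define certifies where "certifies J q \<longleftrightarrow>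
      real_polynomial_function q \<and> (\<exists>F. invertible F \<and> q F \<noteq> 0) \<and>
      (\<forall>F. invertible F \<longrightarrow> q F \<noteq> 0 \<longrightarrow> m \<le> dim (ext_proj F J ` W))" for J and q :: "'n rmat \<Rightarrow> real"
  have "\<exists>q. certifies J q" if J: "card J = ?n - d" for J
  proof -
    obtain F where "invertible F" "ext_proj F J = ext_proj F1 J1"
      using ext_proj_relabel[OF 1(3), of J1 J] 1(2) J by auto
    then show ?thesis
      unfolding certifies_def using ext_proj_rank_certificate[OF assms(4), of F J] 1(1) by metis
  qed
  then obtain q where "certifies J (q J)" if "card J = ?n - d" for J
    by metis
  then have q: "\<And>J. card J = ?n - d \<Longrightarrow> real_polynomial_function (q J)"
      "\<And>J. card J = ?n - d \<Longrightarrow> \<exists>F. invertible F \<and> q J F \<noteq> 0"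
      "\<And>J F. card J = ?n - d \<Longrightarrow> invertible F \<Longrightarrow> q J F \<noteq> 0 \<Longrightarrow> m \<le> dim (ext_proj F J ` W)"
    unfolding certifies_def by blast+
  \<comment> \<open>The factor \<open>det\<close> makes the common non-zero an invertible matrix.\<close>
  obtain F0 where F0: "det F0 * q J F0 \<noteq> 0" if "card J = ?n - d" for J
  proof (rule common_nonzero[of "{J :: 'n set. card J = ?n - d}" "\<lambda>J F. det F * q J F"])
    fix J :: "'n set" assume "J \<in> {J. card J = ?n - d}"
    then have J: "card J = ?n - d"
      by simp
    show "real_polynomial_function (\<lambda>F. det F * q J F)"
      by (intro real_polynomial_mult real_polynomial_function_det
          real_polynomial_function_entry q(1) J)
    show "\<exists>F. det F * q J F \<noteq> 0"
      using q(2)[OF J] by (auto simp: invertible_det_nz)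
  qed (simp, blast)
  have inv0: "invertible F0"
    using F0[OF card_J0] by (simp add: invertible_det_nz)
  have m_le: "m \<le> dim (ext_proj F0 (- D) ` W)" if "card D = d" for D
    using q(3)[of "- D" F0] F0[of "- D"] inv0 that
    by (simp add: Compl_eq_Diff_UNIV card_Diff_subset)
  have count: "(?n choose d) * m \<le> dim (wedge_space W (ext_power d UNIV)) * ((r + d) choose d)"
    by (rule wedge_space_growth[OF assms(4,5) inv0 m_le])
  have pos: "0 < ?n choose (r + d)" "0 < (?n - d) choose r" "0 < (r + d) choose d"
    using assms(3) by simp_all
  have "(?n choose (r + d)) * ((r + d) choose d) = (?n choose d) * ((?n - d) choose r)"
    using choose_mult[of d "r + d" ?n] assms(3) by simp
  then have "m * (?n choose (r + d)) * ((r + d) choose d)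
      = (?n choose d) * m * ((?n - d) choose r)"
    by (simp add: ac_simps)
  also have "\<dots> \<le> dim (wedge_space W (ext_power d UNIV)) * ((?n - d) choose r) * ((r + d) choose d)"
    using mult_right_mono[OF count, of "(?n - d) choose r"] by (simp add: ac_simps)
  finally have "m * (?n choose (r + d)) \<le> dim (wedge_space W (ext_power d UNIV)) * ((?n - d) choose r)"
    using pos(3) by simp
  then have "real (m * (?n choose (r + d)))
      \<le> real (dim (wedge_space W (ext_power d UNIV)) * ((?n - d) choose r))"
    by (rule of_nat_mono)
  then have ineq: "real m / real ((?n - d) choose r)
      \<le> real (dim (wedge_space W (ext_power d UNIV))) / real (?n choose (r + d))"
    using pos by (simp add: divide_simps)
  let ?q = "\<lambda>k. real k / real ((?n - d) choose r)"
  have "{?q (dim (ext_proj F' J ` W)) |J F'. card J = ?n - d \<and> F' \<in> general_linear} = ?q ` dims"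
    by (auto simp: dims_def general_linear_def)
  moreover have "?q m = Max (?q ` dims)"
    unfolding m_def
    by (rule mono_Max_commute) (use fin \<open>m \<in> dims\<close> in \<open>auto intro!: monoI divide_right_mono\<close>)
  ultimately have Max: "Max {?q (dim (ext_proj F' J ` W)) |J F'.
      card J = ?n - d \<and> F' \<in> general_linear} = ?q m"
    by simp
  define U where "U = general_linear - {F. \<forall>p\<in>{q ?J0}. p F = 0}"
  have "zariski_closed {F. \<forall>p\<in>{q ?J0}. p F = 0}"
    unfolding zariski_closed_def by (rule exI[of _ "{q ?J0}"]) (simp add: q(1)[OF card_J0])
  then have "zariski_open_in_GL U"
    unfolding zariski_open_in_GL_def U_def by blast
  moreover have "U \<noteq> {}"
    using q(2)[OF card_J0] by (auto simp: U_def general_linear_def)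
  moreover have dim_m: "dim (ext_proj F ?J0 ` W) = m" if "F \<in> U" for F
  proof (rule antisym)
    have F: "invertible F" "q ?J0 F \<noteq> 0"
      using that by (simp_all add: U_def general_linear_def)
    show "dim (ext_proj F ?J0 ` W) \<le> m"
      using le_m card_J0 F(1) by blast
    show "m \<le> dim (ext_proj F ?J0 ` W)"
      by (rule q(3)[OF card_J0 F])
  qed
  ultimately show ?thesis
    using ineq by (intro exI[of _ U] conjI ballI) (simp_all only: Max dim_m simp_thms)
qed

end
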